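(* Let $0<p<1$, let $\mu_p$ be a probability measure on $[0,1]$, absolutely continuous with respect to Lebesgue measure with density of bounded variation, such that $m_p\otimes\mu_p$ is invariant for $R$, and let $h_p$ be its (lower semi-continuous) probability density function. Then $h_p(x)>0$ for all $x\in[0,1)$.
   Context: $\Omega=\{0,1\}^{\mathbb{N}}$ with elements $\omega=(\omega_k)_{k\ge1}$, and $\sigma$ is the left shift on $\Omega$. The Gauss map $T_0:[0,1]\to[0,1]$ is $T_0(0)=0$ and $T_0x=\frac1x \pmod 1$ for $x\ne0$; the R\'enyi map $T_1:[0,1]\to[0,1]$ is $T_1(1)=0$ and $T_1x=\frac1{1-x}\pmod 1$ for $x\neq1$. The map $R:\Omega\times[0,1]\to\Omega\times[0,1]$ is $R(\omega,x)=(\sigma\omega,T_{\omega_1}x)$. $m_p$ is the $(p,1-p)$-Bernoulli measure on $\Omega$ (symbol $0$ has probability $p$, symbol $1$ has probability $1-p$). Such a measure $\mu_p$ exists for every $0<p<1$. Convention on the version of the density: a density of bounded variation is modified at countably many points so as to be lower semi-continuous; concretely, $h_p(x)$ is the minimum of the left and right limits at $x\in(0,1)$ of a bounded variation version of the density, and $h_p(0)$, $h_p(1)$ are the one-sided limits at the endpoints. *)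

theory Defs
  imports "HOL-Probability.Probability"
begin

text \<open>
  A sequence \<open>\<omega> = (\<omega>\<^sub>1, \<omega>\<^sub>2, \<dots>)\<close> of symbols in \<open>{0, 1}\<close> is a function \<open>\<omega> :: nat \<Rightarrow> bool\<close>,
  where \<open>\<omega> k\<close> stands for \<open>\<omega>\<^sub>k\<^sub>+\<^sub>1\<close>, \<open>False\<close> for the symbol 0 and \<open>True\<close> for the symbol 1.
\<close>

definition left_shift :: "(nat \<Rightarrow> bool) \<Rightarrow> (nat \<Rightarrow> bool)" where
  "left_shift \<omega> = (\<lambda>k. \<omega> (Suc k))"

text \<open>The parameter \<open>p\<close> is the probability of the symbol 0, that is, of \<open>False\<close>.\<close>

definition bernoulli_measure :: "real \<Rightarrow> (nat \<Rightarrow> bool) measure" where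
  "bernoulli_measure p = PiM UNIV (\<lambda>_. measure_pmf (bernoulli_pmf (1 - p)))"

definition gauss_map :: "real \<Rightarrow> real" where
  "gauss_map x = (if x = 0 then 0 else frac (1 / x))"

definition renyi_map :: "real \<Rightarrow> real" where
  "renyi_map x = (if x = 1 then 0 else frac (1 / (1 - x)))"

definition random_map :: "(nat \<Rightarrow> bool) \<times> real \<Rightarrow> (nat \<Rightarrow> bool) \<times> real" where
  "random_map = (\<lambda>(\<omega>, x). (left_shift \<omega>, if \<omega> 0 then renyi_map x else gauss_map x))"

text \<open>
  Only meaningful for a transformation that is measurable on \<open>M\<close>; see
  \<open>measurable_random_map\<close> below.
\<close>

definition invariant_measure :: "'a measure \<Rightarrow> ('a \<Rightarrow> 'a) \<Rightarrow> bool" where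
  "invariant_measure M S \<longleftrightarrow> distr M M S = M"

definition bounded_variation_on :: "real \<Rightarrow> real \<Rightarrow> (real \<Rightarrow> real) \<Rightarrow> bool" where
  "bounded_variation_on a b f \<longleftrightarrow>
     (\<exists>V. \<forall>(n::nat) t. (\<forall>i\<le>n. t i \<in> {a..b}) \<and> (\<forall>i<n. t i \<le> t (Suc i)) \<longrightarrow>
        (\<Sum>i<n. \<bar>f (t (Suc i)) - f (t i)\<bar>) \<le> V)"

text \<open>
  \<open>bv_density \<mu> f\<close>: the measure \<open>\<mu>\<close> on \<open>[0, 1]\<close> is absolutely continuous with respect to Lebesgue
  measure, and \<open>f\<close> is a version of its density that has bounded variation. Nonnegativity is
  required only almost everywhere, so that every version is admitted.
\<close>

definition bv_density :: "real measure \<Rightarrow> (real \<Rightarrow> real) \<Rightarrow> bool" where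
  "bv_density \<mu> f \<longleftrightarrow>
     bounded_variation_on 0 1 f \<and>
     f \<in> borel_measurable (restrict_space lborel {0..1}) \<and>
     (AE x in restrict_space lborel {0..1}. 0 \<le> f x) \<and>
     \<mu> = density (restrict_space lborel {0..1}) (\<lambda>x. ennreal (f x))"

text \<open>
  For \<open>f\<close> of bounded variation on \<open>[0, 1]\<close> all the one-sided limits used here exist; they do not
  change when \<open>f\<close> is replaced by another such function that agrees with it almost everywhere.
\<close>

definition lsc_version :: "(real \<Rightarrow> real) \<Rightarrow> real \<Rightarrow> real" where
  "lsc_version f x =
     (if x = 0 then Lim (at_right 0) f
      else if x = 1 then Lim (at_left 1) f
      else min (Lim (at_left x) f) (Lim (at_right x) f))"

definition lsc_density :: "real measure \<Rightarrow> (real \<Rightarrow> real) \<Rightarrow> bool" where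
  "lsc_density \<mu> h \<longleftrightarrow> (\<exists>f. bv_density \<mu> f \<and> (\<forall>x\<in>{0..1}. h x = lsc_version f x))"

lemma sets_bernoulli_measure [measurable_cong]:
  "sets (bernoulli_measure p) = sets (PiM UNIV (\<lambda>_. count_space UNIV))"
  unfolding bernoulli_measure_def by (intro sets_PiM_cong) auto

lemma gauss_map_measurable [measurable]: "gauss_map \<in> borel_measurable borel"
  unfolding gauss_map_def frac_def by measurable

lemma renyi_map_measurable [measurable]: "renyi_map \<in> borel_measurable borel"
  unfolding renyi_map_def frac_def by measurable

lemma left_shift_measurable [measurable]:
  "left_shift \<in> PiM UNIV (\<lambda>_. count_space UNIV) \<rightarrow>\<^sub>M PiM UNIV (\<lambda>_. count_space UNIV)"
  unfolding left_shift_def by (rule measurable_PiM_single') auto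

lemma measurable_random_map:
  assumes "sets \<mu> = sets (restrict_space borel {0..1})"
  shows "random_map \<in> (bernoulli_measure p \<Otimes>\<^sub>M \<mu>) \<rightarrow>\<^sub>M (bernoulli_measure p \<Otimes>\<^sub>M \<mu>)"
proof -
  let ?B = "PiM UNIV (\<lambda>_. count_space UNIV) :: (nat \<Rightarrow> bool) measure"
  let ?I = "restrict_space borel {0..1} :: real measure"
  have [measurable]: "(\<lambda>x. x) \<in> ?I \<rightarrow>\<^sub>M borel"
    by (rule measurable_restrict_space1) simp
  have [measurable]: "gauss_map \<in> ?I \<rightarrow>\<^sub>M ?I" "renyi_map \<in> ?I \<rightarrow>\<^sub>M ?I"
    by (auto intro!: measurable_restrict_space2 measurable_restrict_space1
             simp: gauss_map_def renyi_map_def frac_ge_0 less_imp_le[OF frac_lt_1])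
  have [measurable]: "(\<lambda>\<omega>. \<omega> 0) \<in> ?B \<rightarrow>\<^sub>M count_space UNIV"
    by (rule measurable_component_singleton) simp
  have "random_map \<in> ?B \<Otimes>\<^sub>M ?I \<rightarrow>\<^sub>M ?B \<Otimes>\<^sub>M ?I"
    unfolding random_map_def by measurable
  moreover have "sets (bernoulli_measure p \<Otimes>\<^sub>M \<mu>) = sets (?B \<Otimes>\<^sub>M ?I)"
    by (intro sets_pair_measure_cong sets_bernoulli_measure assms)
  ultimately show ?thesis
    by (simp cong: measurable_cong_sets)
qed

end

theory Submission
  imports Defs
begin

text \<open>
  Call a point \<open>x\<close> of \<open>[0, 1]\<close> good if \<open>\<mu>\<close> dominates a positive multiple of Lebesgue measure near
  \<open>x\<close>; this is positivity of the lower semi-continuous density at \<open>x\<close>. By invariance, \<open>\<mu>\<close>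
  dominates \<open>p\<close> times its push-forward under the Gauss map, so \<open>x\<close> is good as soon as one of its
  preimages \<open>1 / (k + x)\<close> is. A density of bounded variation with integral 1 exceeds a positive
  constant on some interval, so there is a good rational point. The Gauss map acts on rationals as
  the Euclidean algorithm and takes each of them to 0, so 0 is good. Finally, every \<open>x\<close> in
  \<open>[0, 1]\<close> has preimages arbitrarily close to 0, hence is good.
\<close>

section \<open>One-sided limits of functions of bounded variation\<close>

text \<open>Take for \<open>V t\<close> the total variation of \<open>f\<close> over
  \<open>{a..t}\<close>: appending \<open>s\<close> and \<open>t\<close> to a partition of
  \<open>{a..s}\<close> adds at least the distance from \<open>f s\<close> to \<open>f t\<close>.
  The bound makes both \<open>V\<close> and \<open>V - f\<close> nondecreasing.\<close>

lemma bounded_variation_majorant: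
  assumes "bounded_variation_on a b f"
  shows "\<exists>V. \<forall>s t. a \<le> s \<and> s \<le> t \<and> t \<le> b \<longrightarrow> \<bar>f t - f s\<bar> \<le> V t - V s"
proof -
  define W where "W t = {(\<Sum>i<n. \<bar>f (s (Suc i)) - f (s i)\<bar>) | n s.
    (\<forall>i\<le>n. s i \<in> {a..t}) \<and> (\<forall>i<(n::nat). s i \<le> s (Suc i))}" for t
  define V where "V t = Sup (W t)" for t
  from assms obtain K where K: "\<And>n s. (\<forall>i\<le>n. s i \<in> {a..b}) \<Longrightarrow> (\<forall>i<(n::nat). s i \<le> s (Suc i)) \<Longrightarrow>
      (\<Sum>i<n. \<bar>f (s (Suc i)) - f (s i)\<bar>) \<le> K"
    unfolding bounded_variation_on_def by blast
  have bdd: "bdd_above (W t)" if "t \<le> b" for t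
  proof (rule bdd_aboveI)
    fix w assume "w \<in> W t"
    then obtain n s where w: "w = (\<Sum>i<n. \<bar>f (s (Suc i)) - f (s i)\<bar>)"
      and s: "\<forall>i\<le>n. s i \<in> {a..t}" "\<forall>i<n. s i \<le> s (Suc i)"
      unfolding W_def by auto
    show "w \<le> K"
      unfolding w using s that by (intro K) force+
  qed
  have "\<bar>f t - f s\<bar> \<le> V t - V s" if st: "a \<le> s" "s \<le> t" "t \<le> b" for s t
  proof -
    have "W s \<noteq> {}"
      unfolding W_def using st by (auto intro!: exI[of _ 0] exI[of _ "\<lambda>_. s"])
    moreover have "w \<le> V t - \<bar>f t - f s\<bar>" if wW: "w \<in> W s" for w
    proof -
      obtain n :: nat and r where w: "w = (\<Sum>i<n. \<bar>f (r (Suc i)) - f (r i)\<bar>)"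
        and r: "\<forall>i\<le>n. r i \<in> {a..s}" "\<forall>i<n. r i \<le> r (Suc i)"
        using wW unfolding W_def by auto
      define q where "q i = (if i \<le> n then r i else if i = Suc n then s else t)" for i
      have "(\<Sum>i<Suc (Suc n). \<bar>f (q (Suc i)) - f (q i)\<bar>) \<in> W t"
      proof -
        have "\<forall>i\<le>Suc (Suc n). q i \<in> {a..t}"
          using r st unfolding q_def by (auto intro: order_trans)
        moreover have "\<forall>i<Suc (Suc n). q i \<le> q (Suc i)"
        proof (intro allI impI)
          fix i assume "i < Suc (Suc n)"
          then consider "i < n" | "i = n" | "i = Suc n" by linarith
          then show "q i \<le> q (Suc i)"
            using r(1)[rule_format, of n] r(2)[rule_format, of i] st unfolding q_def by cases auto
        qed
        ultimately show ?thesis unfolding W_def by blast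
      qed
      then have "(\<Sum>i<Suc (Suc n). \<bar>f (q (Suc i)) - f (q i)\<bar>) \<le> V t"
        unfolding V_def using bdd st by (intro cSup_upper) auto
      moreover have "w = (\<Sum>i<n. \<bar>f (q (Suc i)) - f (q i)\<bar>)"
        unfolding w by (intro sum.cong) (auto simp: q_def)
      ultimately show ?thesis by (simp add: q_def)
    qed
    ultimately have "V s \<le> V t - \<bar>f t - f s\<bar>"
      unfolding V_def by (intro cSup_least) auto
    then show ?thesis by simp
  qed
  then show ?thesis by blast
qed

text \<open>Jordan decomposition: \<open>f = V - (V - f)\<close> is a difference of functions that
  are nondecreasing on \<open>{a..b}\<close>, and these have one-sided limits.\<close>

lemma bounded_variation_at_right:
  assumes bv: "bounded_variation_on a b f" and x: "a \<le> x" "x < b"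
  obtains l where "(f \<longlongrightarrow> l) (at_right x)"
proof -
  obtain V where V: "\<forall>s t. a \<le> s \<and> s \<le> t \<and> t \<le> b \<longrightarrow> \<bar>f t - f s\<bar> \<le> V t - V s"
    using bounded_variation_majorant[OF bv] by blast
  \<comment> \<open>Monotonicity is known only up to \<open>b\<close>; as \<open>x < b\<close>,
    cutting there leaves the filter of right neighbourhoods unchanged.\<close>
  have at: "at x within ({x<..} \<inter> {..b}) = at_right x"
    by (rule at_within_nhd[of x "{..<b}"]) (use x in auto)
  have lim: "\<exists>l. (g \<longlongrightarrow> l) (at_right x)"
    if "\<And>s t. a \<le> s \<Longrightarrow> s \<le> t \<Longrightarrow> t \<le> b \<Longrightarrow> g s \<le> g t" for g :: "real \<Rightarrow> real"
    using Lim_right_bound[of "{..b}" x g "g x", unfolded at] that x by fastforce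
  have "V s \<le> V t" "V s - f s \<le> V t - f t" if "a \<le> s" "s \<le> t" "t \<le> b" for s t
    using V[rule_format, of s t] that by auto
  note mono = this
  obtain l where "(V \<longlongrightarrow> l) (at_right x)"
    using lim[of V, OF mono(1)] by blast
  moreover obtain l' where "((\<lambda>t. V t - f t) \<longlongrightarrow> l') (at_right x)"
    using lim[of "\<lambda>t. V t - f t", OF mono(2)] by blast
  ultimately have "((\<lambda>t. V t - (V t - f t)) \<longlongrightarrow> l - l') (at_right x)"
    by (rule tendsto_diff)
  then show thesis by (intro that) simp
qed

lemma bounded_variation_at_left:
  assumes bv: "bounded_variation_on a b f" and x: "a < x" "x \<le> b"
  obtains l where "(f \<longlongrightarrow> l) (at_left x)"
proof -
  obtain V where V: "\<forall>s t. a \<le> s \<and> s \<le> t \<and> t \<le> b \<longrightarrow> \<bar>f t - f s\<bar> \<le> V t - V s"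
    using bounded_variation_majorant[OF bv] by blast
  have at: "at x within ({..<x} \<inter> {a..}) = at_left x"
    by (rule at_within_nhd[of x "{a<..}"]) (use x in auto)
  have lim: "\<exists>l. (g \<longlongrightarrow> l) (at_left x)"
    if "\<And>s t. a \<le> s \<Longrightarrow> s \<le> t \<Longrightarrow> t \<le> b \<Longrightarrow> g s \<le> g t" for g :: "real \<Rightarrow> real"
    using Lim_left_bound[of "{a..}" x g "g x", unfolded at] that x by fastforce
  have "V s \<le> V t" "V s - f s \<le> V t - f t" if "a \<le> s" "s \<le> t" "t \<le> b" for s t
    using V[rule_format, of s t] that by auto
  note mono = this
  obtain l where "(V \<longlongrightarrow> l) (at_left x)"
    using lim[of V, OF mono(1)] by blast
  moreover obtain l' where "((\<lambda>t. V t - f t) \<longlongrightarrow> l') (at_left x)"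
    using lim[of "\<lambda>t. V t - f t", OF mono(2)] by blast
  ultimately have "((\<lambda>t. V t - (V t - f t)) \<longlongrightarrow> l - l') (at_left x)"
    by (rule tendsto_diff)
  then show thesis by (intro that) simp
qed

section \<open>Local positivity and the branches of the Gauss map\<close>

text \<open>
  Testing intervals suffices because the density has one-sided limits everywhere, and the inverse
  branches of the Gauss map take intervals to intervals.
\<close>

definition locally_pos :: "real measure \<Rightarrow> real \<Rightarrow> bool" where
  "locally_pos \<mu> x \<longleftrightarrow> (\<exists>c>0. \<exists>\<delta>>0. \<forall>u v. 0 \<le> u \<longrightarrow> u < v \<longrightarrow> v \<le> 1 \<longrightarrow> \<bar>u - x\<bar> < \<delta> \<longrightarrow> \<bar>v - x\<bar> < \<delta> \<longrightarrow>
     ennreal (c * (v - u)) \<le> emeasure \<mu> {u<..<v})"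

lemma prob_space_bernoulli_measure: "prob_space (bernoulli_measure p)"
  unfolding bernoulli_measure_def by (intro prob_space_PiM prob_space_measure_pmf)

lemma emeasure_bernoulli_first_symbol:
  assumes "0 < p" "p < 1"
  shows "emeasure (bernoulli_measure p) {\<omega>. \<not> \<omega> 0} = ennreal p"
proof -
  let ?M = "\<lambda>_::nat. measure_pmf (bernoulli_pmf (1 - p))"
  have "distr (PiM UNIV ?M) (measure_pmf (bernoulli_pmf (1 - p))) (\<lambda>\<omega>. \<omega> 0) = measure_pmf (bernoulli_pmf (1 - p))"
    by (rule distr_PiM_component) (auto intro: prob_space_measure_pmf)
  then have "emeasure (measure_pmf (bernoulli_pmf (1 - p))) {False} =
      emeasure (distr (PiM UNIV ?M) (measure_pmf (bernoulli_pmf (1 - p))) (\<lambda>\<omega>. \<omega> 0)) {False}"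
    by simp
  also have "\<dots> = emeasure (PiM UNIV ?M) ((\<lambda>\<omega>. \<omega> 0) -` {False} \<inter> space (PiM UNIV ?M))"
    by (rule emeasure_distr) auto
  also have "(\<lambda>\<omega>. \<omega> 0) -` {False} \<inter> space (PiM UNIV ?M) = {\<omega>. \<not> \<omega> 0}"
    by (auto simp: space_PiM)
  finally show ?thesis
    using assms by (simp add: bernoulli_measure_def emeasure_pmf_single)
qed

text \<open>The sequences with first symbol 0, paired with \<open>A'\<close>, form a rectangle of
  measure \<open>p\<close> times that of \<open>A'\<close>. The random map acts there by the Gauss
  map and sends it into \<open>UNIV \<times> A\<close>, so invariance gives the bound; the Renyi
  branch contributes only more mass.\<close>

lemma invariant_gauss_lower_bound:
  assumes p: "0 < p" "p < 1" and \<mu>: "prob_space \<mu>" "sets \<mu> = sets (restrict_space borel {0..1})"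
    and inv: "invariant_measure (bernoulli_measure p \<Otimes>\<^sub>M \<mu>) random_map"
    and A: "A \<in> sets \<mu>" "A' \<in> sets \<mu>" "gauss_map ` A' \<subseteq> A"
  shows "ennreal p * emeasure \<mu> A' \<le> emeasure \<mu> A"
proof -
  let ?B = "bernoulli_measure p"
  interpret B: prob_space ?B by (rule prob_space_bernoulli_measure)
  interpret M: prob_space \<mu> by (rule \<mu>)
  have space: "space ?B = UNIV"
    unfolding bernoulli_measure_def by (simp add: space_PiM)
  \<comment> \<open>A set outside the sigma-algebra has \<open>emeasure\<close> 0 by default, so the
    positive value \<open>p\<close> forces measurability.\<close>
  have cyl: "{\<omega>. \<not> \<omega> 0} \<in> sets ?B"
    using emeasure_bernoulli_first_symbol[OF p] p emeasure_notin_sets[of "{\<omega>. \<not> \<omega> 0}" ?B] by auto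
  have UN: "UNIV \<in> sets ?B"
    using sets.top[of ?B] by (simp add: space)
  have "ennreal p * emeasure \<mu> A' = emeasure (?B \<Otimes>\<^sub>M \<mu>) ({\<omega>. \<not> \<omega> 0} \<times> A')"
    by (simp add: M.emeasure_pair_measure_Times cyl A emeasure_bernoulli_first_symbol[OF p])
  also have "\<dots> \<le> emeasure (?B \<Otimes>\<^sub>M \<mu>) (random_map -` (UNIV \<times> A) \<inter> space (?B \<Otimes>\<^sub>M \<mu>))"
  proof (rule emeasure_mono)
    show "random_map -` (UNIV \<times> A) \<inter> space (?B \<Otimes>\<^sub>M \<mu>) \<in> sets (?B \<Otimes>\<^sub>M \<mu>)"
      using measurable_random_map[OF \<mu>(2)] UN A(1) by (intro measurable_sets) auto
    show "{\<omega>. \<not> \<omega> 0} \<times> A' \<subseteq> random_map -` (UNIV \<times> A) \<inter> space (?B \<Otimes>\<^sub>M \<mu>)"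
      using A(3) sets.sets_into_space[OF A(2)] by (auto simp: random_map_def space_pair_measure space)
  qed
  also have "\<dots> = emeasure (distr (?B \<Otimes>\<^sub>M \<mu>) (?B \<Otimes>\<^sub>M \<mu>) random_map) (UNIV \<times> A)"
    using measurable_random_map[OF \<mu>(2)] UN A(1) by (intro emeasure_distr[symmetric]) auto
  also have "\<dots> = emeasure (?B \<Otimes>\<^sub>M \<mu>) (UNIV \<times> A)"
    using inv by (simp add: invariant_measure_def)
  also have "\<dots> = emeasure \<mu> A"
    using B.emeasure_space_1 UN A by (simp add: M.emeasure_pair_measure_Times space)
  finally show ?thesis .
qed

text \<open>Intervals near \<open>x\<close> are pulled back by the inverse branch
  \<open>1 / (k + x)\<close> and compared through invariance. Since only open intervals enter,
  \<open>x = 1\<close> is covered, although the Gauss map sends \<open>1 / (k + 1)\<close> to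
  0.\<close>

lemma locally_pos_gauss_branch:
  fixes k :: nat and x :: real
  assumes p: "0 < p" "p < 1" and \<mu>: "prob_space \<mu>" "sets \<mu> = sets (restrict_space borel {0..1})"
    and inv: "invariant_measure (bernoulli_measure p \<Otimes>\<^sub>M \<mu>) random_map"
    and k: "1 \<le> k" and x: "0 \<le> x" "x \<le> 1" and pos: "locally_pos \<mu> (1 / (real k + x))"
  shows "locally_pos \<mu> x"
proof -
  obtain c \<delta> where c: "0 < c" "0 < \<delta>"
    and low: "\<And>u v. 0 \<le> u \<Longrightarrow> u < v \<Longrightarrow> v \<le> 1 \<Longrightarrow> \<bar>u - 1 / (real k + x)\<bar> < \<delta> \<Longrightarrow> \<bar>v - 1 / (real k + x)\<bar> < \<delta> \<Longrightarrow>
      ennreal (c * (v - u)) \<le> emeasure \<mu> {u<..<v}"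
    using pos unfolding locally_pos_def by blast
  have sub: "{u<..<v} \<in> sets \<mu>" if "0 \<le> u" "v \<le> 1" for u v :: real
    using that by (auto simp: \<mu> sets_restrict_space_iff)
  have diff: "1 / (real k + u) - 1 / (real k + v) = (v - u) / ((real k + u) * (real k + v))" if "0 \<le> u" "0 \<le> v" for u v :: real
  proof -
    have "real k + u > 0" "real k + v > 0" using that k by auto
    then show ?thesis by (simp add: divide_simps)
  qed
  \<comment> \<open>As \<open>k \<ge> 1\<close>, the inverse branch is 1-Lipschitz, so the radius
    \<open>\<delta>\<close> can be kept.\<close>
  have near: "\<bar>1 / (real k + u) - 1 / (real k + x)\<bar> < \<delta>" if "0 \<le> u" "\<bar>u - x\<bar> < \<delta>" for u :: real
  proof -
    have 1: "1 * 1 \<le> (real k + u) * (real k + x)" using that k x by (intro mult_mono) auto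
    have "\<bar>1 / (real k + u) - 1 / (real k + x)\<bar> = \<bar>u - x\<bar> / ((real k + u) * (real k + x))"
      using diff[of u x] that x 1 by (simp add: abs_divide abs_minus_commute)
    also have "\<dots> \<le> \<bar>u - x\<bar> / 1" using 1 by (intro divide_left_mono) auto
    finally show ?thesis using that by simp
  qed
  \<comment> \<open>The factor \<open>p\<close> comes from invariance; \<open>1 / (k + 1)^2\<close>
    bounds from below the contraction of lengths by the inverse branch on
    \<open>[0, 1]\<close>.\<close>
  have "ennreal (p * (c / (real k + 1)\<^sup>2) * (v - u)) \<le> emeasure \<mu> {u<..<v}"
    if uv: "0 \<le> u" "u < v" "v \<le> 1" "\<bar>u - x\<bar> < \<delta>" "\<bar>v - x\<bar> < \<delta>" for u v :: real
  proof -
    \<comment> \<open>The inverse branch is decreasing, so the endpoints change places.\<close>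
    define u' v' where "u' = 1 / (real k + v)" and "v' = 1 / (real k + u)"
    have uv': "0 \<le> u'" "u' < v'" "v' \<le> 1"
      using k uv by (auto simp: u'_def v'_def divide_simps)
    have prod: "(real k + u) * (real k + v) \<le> (real k + 1)\<^sup>2"
      unfolding power2_eq_square using uv by (intro mult_mono) auto
    have pp: "0 < (real k + u) * (real k + v)" using uv k by (intro mult_pos_pos) auto
    have "c / (real k + 1)\<^sup>2 * (v - u) = c * ((v - u) / (real k + 1)\<^sup>2)" by simp
    also have "\<dots> \<le> c * (v' - u')"
      unfolding u'_def v'_def using prod uv c pp
      by (subst diff) (auto intro!: mult_left_mono divide_left_mono mult_pos_pos)
    finally have "p * (c / (real k + 1)\<^sup>2 * (v - u)) \<le> p * (c * (v' - u'))"
      using p by (intro mult_left_mono) auto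
    then have "ennreal (p * (c / (real k + 1)\<^sup>2) * (v - u)) \<le> ennreal p * ennreal (c * (v' - u'))"
      unfolding ennreal_mult'[OF less_imp_le[OF p(1)], symmetric] mult.assoc by (rule ennreal_leI)
    also have "\<dots> \<le> ennreal p * emeasure \<mu> {u'<..<v'}"
      using uv uv' by (intro mult_left_mono low) (auto simp: u'_def v'_def near)
    also have "\<dots> \<le> emeasure \<mu> {u<..<v}"
    proof (rule invariant_gauss_lower_bound[OF p \<mu> inv])
      show "gauss_map ` {u'<..<v'} \<subseteq> {u<..<v}"
      proof clarify
        fix y assume y: "y \<in> {u'<..<v'}"
        then have y0: "0 < y" using uv' by auto
        have "real k + u > 0" "real k + v > 0" using uv k by auto
        then have *: "real k + u < 1 / y" "1 / y < real k + v"
          using y y0 by (auto simp: u'_def v'_def field_simps)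
        then have "\<lfloor>1 / y\<rfloor> = int k" using uv by (intro floor_unique) auto
        then have "gauss_map y = 1 / y - k" using y0 by (simp add: gauss_map_def frac_def)
        then show "gauss_map y \<in> {u<..<v}" using * by auto
      qed
    qed (use uv uv' sub in auto)
    finally show ?thesis .
  qed
  moreover have "p * (c / (real k + 1)\<^sup>2) > 0" using p c by (simp add: zero_less_power)
  ultimately show ?thesis
    unfolding locally_pos_def using c(2) by (intro exI[of _ "p * (c / (real k + 1)\<^sup>2)"] exI[of _ \<delta>] conjI allI impI)
qed

section \<open>The Euclidean algorithm and propagation to \<open>[0, 1]\<close>\<close>

text \<open>Descent on the numerator: with \<open>b = k * a + r\<close>, the fraction
  \<open>a / b\<close> equals \<open>1 / (k + r / a)\<close>, so a branch passes from
  \<open>a / b\<close> to \<open>r / a\<close> with \<open>r < a\<close>. The condition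
  \<open>a \<le> b\<close> ensures \<open>k \<ge> 1\<close> and persists.\<close>

lemma locally_pos_rational_imp_zero:
  assumes branch: "\<And>(k::nat) x. 1 \<le> k \<Longrightarrow> 0 \<le> x \<Longrightarrow> x \<le> 1 \<Longrightarrow> P (1 / (real k + x)) \<Longrightarrow> P x"
    and "a \<le> b" "0 < b" "P (real a / real b)"
  shows "P (0::real)"
  using assms(2-)
proof (induction a arbitrary: b rule: less_induct)
  case (less a)
  show ?case
  proof (cases "a = 0")
    case True
    then show ?thesis using less.prems by simp
  next
    case False
    define k r where "k = b div a" and "r = b mod a"
    have b: "real b = k * a + r" unfolding k_def r_def
      by (metis div_mult_mod_eq of_nat_add of_nat_mult)
    have k: "1 \<le> k" using less.prems False by (simp add: k_def div_greater_zero_iff Suc_le_eq)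
    have r: "r < a" using False by (simp add: r_def)
    have "1 / (real k + real r / real a) = real a / real b"
      using False by (simp add: b divide_simps)
    then have "P (real r / real a)"
      using branch[OF k, of "real r / real a"] less.prems r by simp
    then show ?thesis using less.IH[OF r, of a] r by simp
  qed
qed

lemma locally_pos_everywhere:
  assumes p: "0 < p" "p < 1" and \<mu>: "prob_space \<mu>" "sets \<mu> = sets (restrict_space borel {0..1})"
    and inv: "invariant_measure (bernoulli_measure p \<Otimes>\<^sub>M \<mu>) random_map"
    and y: "0 \<le> y" "y \<le> 1" "y \<in> \<rat>" "locally_pos \<mu> y" and x: "0 \<le> x" "x \<le> 1"
  shows "locally_pos \<mu> x"
proof -
  note branch = locally_pos_gauss_branch[OF p \<mu> inv]
  obtain a b :: nat where ab: "b \<noteq> 0" "\<bar>y\<bar> = a / b"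
    using Rats_abs_nat_div_natE[OF y(3)] by metis
  then have y_eq: "y = a / b" using y by simp
  then have "real a \<le> real b" using y ab by (simp add: divide_le_eq)
  then have "a \<le> b" by simp
  then have "locally_pos \<mu> 0"
    using locally_pos_rational_imp_zero[of "locally_pos \<mu>" a b, OF branch] ab y y_eq by auto
  then obtain c \<delta> where c: "0 < c" "0 < \<delta>"
    and low: "\<And>u v. 0 \<le> u \<Longrightarrow> u < v \<Longrightarrow> v \<le> 1 \<Longrightarrow> \<bar>u\<bar> < \<delta> \<Longrightarrow> \<bar>v\<bar> < \<delta> \<Longrightarrow>
      ennreal (c * (v - u)) \<le> emeasure \<mu> {u<..<v}"
    unfolding locally_pos_def by auto
  \<comment> \<open>With \<open>k > 1 / \<delta>\<close>, the point \<open>1 / (k + x)\<close> falls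
    in the neighbourhood of 0 where the lower bound holds.\<close>
  obtain n :: nat where n: "1 / \<delta> < n" using reals_Archimedean2 by blast
  define k where "k = Suc n"
  define z where "z = 1 / (real k + x)"
  have z: "0 < z" "z < \<delta>"
    using n c x by (auto simp: z_def k_def field_simps) (smt (verit) mult_nonneg_nonneg)
  \<comment> \<open>Points of \<open>[0, 1]\<close> closer to \<open>z\<close> than
    \<open>\<delta> - z\<close> are closer to 0 than \<open>\<delta>\<close>, so the same
    \<open>c\<close> serves.\<close>
  have "locally_pos \<mu> z"
    unfolding locally_pos_def using c z low
    by (intro exI[of _ c] conjI exI[of _ "\<delta> - z"]) auto
  then show ?thesis
    using branch[of k x] x by (simp add: z_def k_def)
qed

section \<open>Local positivity in terms of the density\<close>

lemma bv_density_sets: "bv_density \<mu> f \<Longrightarrow> sets \<mu> = sets (restrict_space borel {0..1})"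
  unfolding bv_density_def by (auto simp: sets_restrict_space)

lemma emeasure_bv_density:
  assumes f: "bv_density \<mu> f" and uv: "0 \<le> u" "v \<le> 1"
  shows "emeasure \<mu> {u<..<v} = (\<integral>\<^sup>+x\<in>{u<..<v}. ennreal (f x) \<partial>lborel)"
proof -
  have "emeasure \<mu> {u<..<v} = (\<integral>\<^sup>+x. ennreal (f x) * indicator {u<..<v} x \<partial>restrict_space lborel {0..1})"
    using f uv unfolding bv_density_def
    by (auto intro!: emeasure_density simp: sets_restrict_space_iff)
  also have "\<dots> = (\<integral>\<^sup>+x. ennreal (f x) * indicator {u<..<v} x * indicator {0..1} x \<partial>lborel)"
    by (subst nn_integral_restrict_space) auto
  also have "\<dots> = (\<integral>\<^sup>+x\<in>{u<..<v}. ennreal (f x) \<partial>lborel)"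
    using uv by (intro nn_integral_cong) (auto split: split_indicator)
  finally show ?thesis .
qed

lemma emeasure_bv_density_ge:
  assumes f: "bv_density \<mu> f" and uv: "0 \<le> u" "u \<le> v" "v \<le> 1"
    and ge: "\<And>x. u < x \<Longrightarrow> x < v \<Longrightarrow> c \<le> f x"
  shows "ennreal (c * (v - u)) \<le> emeasure \<mu> {u<..<v}"
proof -
  have "ennreal (c * (v - u)) = (\<integral>\<^sup>+x\<in>{u<..<v}. ennreal c \<partial>lborel)"
    using uv by (simp add: nn_integral_cmult_indicator ennreal_mult'')
  also have "\<dots> \<le> emeasure \<mu> {u<..<v}"
    unfolding emeasure_bv_density[OF f uv(1,3)] using ge
    by (intro nn_integral_mono) (auto split: split_indicator intro: ennreal_leI)
  finally show ?thesis .
qed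

lemma emeasure_bv_density_le:
  assumes f: "bv_density \<mu> f" and uv: "0 \<le> u" "u \<le> v" "v \<le> 1"
    and le: "\<And>x. u < x \<Longrightarrow> x < v \<Longrightarrow> f x \<le> c"
  shows "emeasure \<mu> {u<..<v} \<le> ennreal (c * (v - u))"
proof -
  have "emeasure \<mu> {u<..<v} \<le> (\<integral>\<^sup>+x\<in>{u<..<v}. ennreal c \<partial>lborel)"
    unfolding emeasure_bv_density[OF f uv(1,3)] using le
    by (intro nn_integral_mono) (auto split: split_indicator intro: ennreal_leI)
  also have "\<dots> = ennreal (c * (v - u))"
    using uv by (simp add: nn_integral_cmult_indicator ennreal_mult'')
  finally show ?thesis .
qed

text \<open>Near \<open>x\<close> the averages of \<open>f\<close> over intervals are at least
  \<open>c\<close>, so \<open>f\<close> cannot stay below \<open>c / 2\<close> on one of them.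
  Letting \<open>x\<close> be either endpoint serves both one-sided limits.\<close>

lemma locally_pos_density_not_small:
  assumes f: "bv_density \<mu> f" and pos: "locally_pos \<mu> x"
  shows "\<exists>c>0. \<forall>u v. 0 \<le> u \<and> u < v \<and> v \<le> 1 \<and> x \<in> {u, v} \<longrightarrow> (\<exists>t\<in>{u<..<v}. c < f t)"
proof -
  obtain c \<delta> where c: "0 < c" "0 < \<delta>"
    and low: "\<And>u v. 0 \<le> u \<Longrightarrow> u < v \<Longrightarrow> v \<le> 1 \<Longrightarrow> \<bar>u - x\<bar> < \<delta> \<Longrightarrow> \<bar>v - x\<bar> < \<delta> \<Longrightarrow>
      ennreal (c * (v - u)) \<le> emeasure \<mu> {u<..<v}"
    using pos unfolding locally_pos_def by blast
  have "\<exists>t\<in>{u<..<v}. c / 2 < f t" if uv: "0 \<le> u" "u < v" "v \<le> 1" "x \<in> {u, v}" for u v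
  proof (rule ccontr)
    assume "\<not> ?thesis"
    then have small: "f t \<le> c / 2" if "u < t" "t < v" for t using that by (auto simp: not_less)
    \<comment> \<open>Shrinking to within \<open>\<delta>\<close> of \<open>x\<close> keeps
      \<open>x\<close> as an endpoint, so the interval remains nondegenerate.\<close>
    define u' v' where "u' = max u (x - \<delta> / 2)" and "v' = min v (x + \<delta> / 2)"
    have uv': "0 \<le> u'" "u' < v'" "v' \<le> 1" "\<bar>u' - x\<bar> < \<delta>" "\<bar>v' - x\<bar> < \<delta>" "u \<le> u'" "v' \<le> v"
      using uv c by (auto simp: u'_def v'_def)
    have "ennreal (c * (v' - u')) \<le> emeasure \<mu> {u'<..<v'}" using low uv' by blast
    also have "\<dots> \<le> ennreal (c / 2 * (v' - u'))"
      using uv' small by (intro emeasure_bv_density_le[OF f]) auto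
    finally have "c * (v' - u') \<le> c / 2 * (v' - u')"
      using c uv' by (subst (asm) ennreal_le_iff) auto
    then show False using c uv' by auto
  qed
  then show ?thesis using c by (intro exI[of _ "c / 2"]) auto
qed

text \<open>Values above a fixed \<open>c > 0\<close> occur arbitrarily close to \<open>x\<close> on
  the right, so the limit, which exists by bounded variation, is at least \<open>c\<close>.\<close>

lemma Lim_at_right_pos:
  assumes f: "bv_density \<mu> f" and pos: "locally_pos \<mu> x" and x: "0 \<le> x" "x < 1"
  shows "0 < Lim (at_right x) f"
proof -
  obtain c where c: "0 < c"
    "\<forall>u v. 0 \<le> u \<and> u < v \<and> v \<le> 1 \<and> x \<in> {u, v} \<longrightarrow> (\<exists>t\<in>{u<..<v}. c < f t)"
    using locally_pos_density_not_small[OF f pos] by blast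
  have "bounded_variation_on 0 1 f" using f by (simp add: bv_density_def)
  then obtain l where l: "(f \<longlongrightarrow> l) (at_right x)"
    using x by (rule bounded_variation_at_right)
  have "c \<le> l"
  proof (rule ccontr)
    assume "\<not> c \<le> l"
    then have "eventually (\<lambda>t. f t < c) (at_right x)" using order_tendstoD(2)[OF l, of c] by simp
    then obtain b where b: "x < b" "\<forall>t. x < t \<longrightarrow> t < b \<longrightarrow> f t < c"
      unfolding eventually_at_right_field by blast
    obtain t where "t \<in> {x<..<min b 1}" "c < f t"
      using c(2)[rule_format, of x "min b 1"] b x by auto
    then show False using b(2)[rule_format, of t] by auto
  qed
  then show ?thesis using c tendsto_Lim[OF _ l] by simp
qed

lemma Lim_at_left_pos:
  assumes f: "bv_density \<mu> f" and pos: "locally_pos \<mu> x" and x: "0 < x" "x \<le> 1"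
  shows "0 < Lim (at_left x) f"
proof -
  obtain c where c: "0 < c"
    "\<forall>u v. 0 \<le> u \<and> u < v \<and> v \<le> 1 \<and> x \<in> {u, v} \<longrightarrow> (\<exists>t\<in>{u<..<v}. c < f t)"
    using locally_pos_density_not_small[OF f pos] by blast
  have "bounded_variation_on 0 1 f" using f by (simp add: bv_density_def)
  then obtain l where l: "(f \<longlongrightarrow> l) (at_left x)"
    using x by (rule bounded_variation_at_left)
  have "c \<le> l"
  proof (rule ccontr)
    assume "\<not> c \<le> l"
    then have "eventually (\<lambda>t. f t < c) (at_left x)" using order_tendstoD(2)[OF l, of c] by simp
    then obtain b where b: "b < x" "\<forall>t. b < t \<longrightarrow> t < x \<longrightarrow> f t < c"
      unfolding eventually_at_left_field by blast
    obtain t where "t \<in> {max b 0<..<x}" "c < f t"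
      using c(2)[rule_format, of "max b 0" x] b x by auto
    then show False using b(2)[rule_format, of t] by auto
  qed
  then show ?thesis using c tendsto_Lim[OF _ l] by simp
qed

section \<open>An interval on which the density is bounded away from 0\<close>

text \<open>Otherwise all one-sided limits of \<open>f\<close> are at most 0. Then each set where
  \<open>f \<ge> e > 0\<close> is finite, \<open>f\<close> is positive at only countably many
  points, and the total mass is 0 instead of 1.\<close>

lemma bv_density_pos_interval:
  assumes f: "bv_density \<mu> f" and \<mu>: "prob_space \<mu>"
  shows "\<exists>c>0. \<exists>u v. 0 \<le> u \<and> u < v \<and> v \<le> 1 \<and> (\<forall>t. u < t \<longrightarrow> t < v \<longrightarrow> c < f t)"
proof (rule ccontr)
  assume "\<not> ?thesis"
  then have neg: "\<exists>t. u < t \<and> t < v \<and> f t \<le> c" if "0 < c" "0 \<le> u" "u < v" "v \<le> 1" for c u v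
    using that by (meson not_less)
  have bv: "bounded_variation_on 0 1 f" using f by (simp add: bv_density_def)
  have right: "eventually (\<lambda>t. f t < e) (at_right x)" if e: "0 < e" and x: "0 \<le> x" "x < 1" for e x
  proof -
    obtain l where l: "(f \<longlongrightarrow> l) (at_right x)"
      using bounded_variation_at_right[OF bv x] .
    have "l \<le> 0"
    proof (rule ccontr)
      assume "\<not> l \<le> 0"
      then have "eventually (\<lambda>t. l / 2 < f t) (at_right x)" by (intro order_tendstoD(1)[OF l]) auto
      then obtain b where b: "x < b" "\<forall>t. x < t \<longrightarrow> t < b \<longrightarrow> l / 2 < f t"
        unfolding eventually_at_right_field by blast
      obtain t where "x < t" "t < min b 1" "f t \<le> l / 2"
        using neg[of "l / 2" x "min b 1"] x \<open>\<not> l \<le> 0\<close> b(1) by auto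
      then show False using b(2)[rule_format, of t] by auto
    qed
    then show ?thesis using e by (intro order_tendstoD(2)[OF l]) auto
  qed
  have left: "eventually (\<lambda>t. f t < e) (at_left x)" if e: "0 < e" and x: "0 < x" "x \<le> 1" for e x
  proof -
    obtain l where l: "(f \<longlongrightarrow> l) (at_left x)"
      using bounded_variation_at_left[OF bv x] .
    have "l \<le> 0"
    proof (rule ccontr)
      assume "\<not> l \<le> 0"
      then have "eventually (\<lambda>t. l / 2 < f t) (at_left x)" by (intro order_tendstoD(1)[OF l]) auto
      then obtain b where b: "b < x" "\<forall>t. b < t \<longrightarrow> t < x \<longrightarrow> l / 2 < f t"
        unfolding eventually_at_left_field by blast
      obtain t where "max b 0 < t" "t < x" "f t \<le> l / 2"
        using neg[of "l / 2" "max b 0" x] x \<open>\<not> l \<le> 0\<close> b(1) by auto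
      then show False using b(2)[rule_format, of t] by auto
    qed
    then show ?thesis using e by (intro order_tendstoD(2)[OF l]) auto
  qed
  \<comment> \<open>An infinite such set would accumulate at some \<open>x\<close> in
    \<open>[0, 1]\<close>, but the one-sided bounds clear a punctured neighbourhood of
    \<open>x\<close>; beyond the endpoints the set has no points at all.\<close>
  have fin: "finite {x\<in>{0..1}. e \<le> f x}" (is "finite ?S") if "0 < e" for e
  proof (rule ccontr)
    assume "infinite ?S"
    then obtain x where x: "x \<in> {0..1}" "x islimpt ?S"
      using compact_eq_Bolzano_Weierstrass[of "{0..1::real}"] by blast
    have "eventually (\<lambda>t. t \<notin> ?S) (at_right x)"
    proof (cases "x < 1")
      case True
      with right[OF that, of x] x show ?thesis by (auto elim: eventually_mono)
    next
      case False
      then show ?thesis using x eventually_at_right_less[of x] by (auto elim: eventually_mono)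
    qed
    moreover have "eventually (\<lambda>t. t \<notin> ?S) (at_left x)"
    proof (cases "0 < x")
      case True
      with left[OF that, of x] x show ?thesis by (auto elim: eventually_mono)
    next
      case False
      have "eventually (\<lambda>t. t < x) (at_left x)" by (simp add: eventually_at_filter)
      then show ?thesis using x False by (auto elim: eventually_mono)
    qed
    ultimately show False
      using x(2) by (simp add: islimpt_iff_eventually eventually_at_split)
  qed
  have "{x\<in>{0..1}. 0 < f x} \<subseteq> (\<Union>n. {x\<in>{0..1}. inverse (real (Suc n)) \<le> f x})"
    using reals_Archimedean less_imp_le by fastforce
  moreover have "countable (\<Union>n. {x\<in>{0..1}. inverse (real (Suc n)) \<le> f x})"
    by (rule countable_UN[OF countableI_type countable_finite[OF fin]]) simp
  ultimately have "{x\<in>{0..1}. 0 < f x} \<in> null_sets lborel"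
    by (intro countable_imp_null_set_lborel) (rule countable_subset)
  \<comment> \<open>\<open>ennreal\<close> truncates negative values to 0, so
    \<open>f x \<le> 0\<close> suffices.\<close>
  from AE_not_in[OF this] have "AE x in lborel. x \<in> {0..1} \<longrightarrow> ennreal (f x) = 0"
    by eventually_elim (auto simp: ennreal_eq_0_iff)
  then have "(\<integral>\<^sup>+x. ennreal (f x) * indicator {0..1} x \<partial>lborel) = (\<integral>\<^sup>+x. 0 \<partial>(lborel::real measure))"
    by (intro nn_integral_cong_AE, eventually_elim) (auto split: split_indicator)
  moreover have "emeasure \<mu> (space \<mu>) = (\<integral>\<^sup>+x. ennreal (f x) * indicator {0..1} x \<partial>lborel)"
  proof -
    have \<mu>_eq: "\<mu> = density (restrict_space lborel {0..1}) (\<lambda>x. ennreal (f x))"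
      and meas: "f \<in> borel_measurable (restrict_space lborel {0..1})"
      using f by (auto simp: bv_density_def)
    have "emeasure \<mu> (space \<mu>) = (\<integral>\<^sup>+x. ennreal (f x) * indicator (space \<mu>) x \<partial>restrict_space lborel {0..1})"
      unfolding \<mu>_eq using meas by (subst emeasure_density) (auto simp: sets_restrict_space_iff)
    also have "\<dots> = (\<integral>\<^sup>+x. ennreal (f x) \<partial>restrict_space lborel {0..1})"
      by (rule nn_integral_cong) (auto simp: \<mu>_eq)
    finally show ?thesis by (simp add: nn_integral_restrict_space)
  qed
  ultimately show False using prob_space.emeasure_space_1[OF \<mu>] by simp
qed

theorem proposition3p3:
  fixes p :: real and \<mu> :: "real measure" and h :: "real \<Rightarrow> real"
  assumes "0 < p" and "p < 1"
    and "prob_space \<mu>"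
    and "invariant_measure (bernoulli_measure p \<Otimes>\<^sub>M \<mu>) random_map"
    and "lsc_density \<mu> h"
  shows "\<forall>x\<in>{0..<1}. 0 < h x"
proof
  fix x :: real assume x: "x \<in> {0..<1}"
  obtain f where f: "bv_density \<mu> f" and h: "\<And>x. x \<in> {0..1} \<Longrightarrow> h x = lsc_version f x"
    using assms(5) unfolding lsc_density_def by blast
  obtain c u v where cuv: "0 < c" "0 \<le> u" "u < v" "v \<le> 1" "\<And>t. u < t \<Longrightarrow> t < v \<Longrightarrow> c < f t"
    using bv_density_pos_interval[OF f assms(3)] by blast
  \<comment> \<open>A rational point is chosen so that the Euclidean descent to 0 applies.\<close>
  obtain y where y: "y \<in> \<rat>" "u < y" "y < v"
    using Rats_dense_in_real[OF cuv(3)] by blast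
  define \<delta> where "\<delta> = min (y - u) (v - y)"
  have "ennreal (c * (t - s)) \<le> emeasure \<mu> {s<..<t}"
    if "0 \<le> s" "s < t" "t \<le> 1" "\<bar>s - y\<bar> < \<delta>" "\<bar>t - y\<bar> < \<delta>" for s t
    using that cuv(5) by (intro emeasure_bv_density_ge[OF f]) (auto simp: \<delta>_def intro!: less_imp_le)
  moreover have "0 < \<delta>" using y by (simp add: \<delta>_def)
  ultimately have "locally_pos \<mu> y"
    unfolding locally_pos_def using cuv(1) by blast
  then have pos: "locally_pos \<mu> x"
    using x y cuv locally_pos_everywhere[OF assms(1-3) bv_density_sets[OF f] assms(4), of y x] by auto
  show "0 < h x"
    \<comment> \<open>At 0 the density is the right limit; at other points of \<open>[0, 1)\<close>
      it is the minimum of two positive limits.\<close>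
    using Lim_at_right_pos[OF f pos] Lim_at_left_pos[OF f pos] x h[of x]
    by (cases "x = 0") (auto simp: lsc_version_def)
qed

end
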